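(* Let $X$ be a compact Hausdorff space equipped with a continuous monoid action $\alpha$ of a monoid $M$. Suppose that the dynamical system $(X,M,\alpha)$ is expansive and has the pseudo-orbit tracing property. Then $(X,M,\alpha)$ is topologically stable.
   Context: A continuous action of a semigroup $S$ on a topological space $X$ is a map $\alpha\colon S\times X\to X$, $(s,x)\mapsto \alpha_s(x)=sx$, with $s(s'x)=(ss')x$ for all $s,s'\in S$, $x\in X$, and such that each $\alpha_s\colon X\to X$ is continuous. If $M$ is a monoid, a monoid action of $M$ is a semigroup action with $1_Mx=x$ for all $x$. No metrizability of $X$ or countability of $M$ is assumed. A compact Hausdorff space $X$ carries a unique uniform structure inducing its topology; its entourages are the neighborhoods of the diagonal in $X\times X$. Expansive: there is an entourage $E$ of $X$ such that for all distinct $x,y\in X$ there exists $m\in M$ with $(mx,my)\notin E$. Pseudo-orbit tracing property: for a finite $K\subset M$ and an entourage $V$, a family $(x_m)_{m\in M}$ of points of $X$ is a $(K,V)$-pseudo-orbit if $(kx_m,x_{km})\in V$ for all $k\in K$, $m\in M$. It is $U$-traced by the orbit of $x\in X$ if $(mx,x_m)\in U$ for all $m\in M$. The system has the pseudo-orbit tracing property if for every entourage $U$ of $X$ there exist a finite subset $K\subset M$ and an entourage $V$ of $X$ such that every $(K,V)$-pseudo-orbit is $U$-traced by the orbit of some point of $X$. Topological stability: let $\mathrm{CMA}_M(X)$ be the set of all continuous monoid actions of $M$ on $X$, with the topology of the uniform structure having as a base of entourages the sets $\{(\alpha,\beta): (\alpha_k(x),\beta_k(x))\in U \text{ for all } k\in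 K, x\in X\}$, where $K$ runs over finite subsets of $M$ and $U$ over entourages of $X$. For $\alpha\in\mathrm{CMA}_M(X)$, $(X,M,\alpha)$ is topologically stable if for every entourage $U$ of $X$ there is a neighborhood $N$ of $\alpha$ in $\mathrm{CMA}_M(X)$ such that for every $\beta\in N$ there is a continuous map $h\colon X\to X$ with $\alpha_m\circ h=h\circ\beta_m$ for all $m\in M$ and $(h(x),x)\in U$ for all $x\in X$. *)

theory Defs
  imports "HOL-Analysis.Analysis"
begin

definition continuous_semigroup_action ::
    "'a topology \<Rightarrow> ('s::semigroup_mult \<Rightarrow> 'a \<Rightarrow> 'a) \<Rightarrow> bool" where
  "continuous_semigroup_action X \<alpha> \<longleftrightarrow>
     (\<forall>s. continuous_map X X (\<alpha> s)) \<and>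
     (\<forall>s s'. \<forall>x\<in>topspace X. \<alpha> s (\<alpha> s' x) = \<alpha> (s * s') x)"

definition continuous_monoid_action ::
    "'a topology \<Rightarrow> ('m::monoid_mult \<Rightarrow> 'a \<Rightarrow> 'a) \<Rightarrow> bool" where
  "continuous_monoid_action X \<alpha> \<longleftrightarrow>
     continuous_semigroup_action X \<alpha> \<and> (\<forall>x\<in>topspace X. \<alpha> 1 x = x)"

text \<open>
  Entourages of the uniform structure of a compact Hausdorff space: the neighbourhoods of the
  diagonal in the product. The definition is only meant for such spaces.
\<close>

definition entourage :: "'a topology \<Rightarrow> ('a \<times> 'a) set \<Rightarrow> bool" where
  "entourage X E \<longleftrightarrow>
     E \<subseteq> topspace X \<times> topspace X \<and>
     (\<forall>x\<in>topspace X. (x, x) \<in> (prod_topology X X) interior_of E)"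

definition expansive :: "'a topology \<Rightarrow> ('m \<Rightarrow> 'a \<Rightarrow> 'a) \<Rightarrow> bool" where
  "expansive X \<alpha> \<longleftrightarrow>
     (\<exists>E. entourage X E \<and>
        (\<forall>x\<in>topspace X. \<forall>y\<in>topspace X. x \<noteq> y \<longrightarrow> (\<exists>m. (\<alpha> m x, \<alpha> m y) \<notin> E)))"

definition pseudo_orbit ::
    "'a topology \<Rightarrow> ('m::monoid_mult \<Rightarrow> 'a \<Rightarrow> 'a) \<Rightarrow> 'm set \<Rightarrow> ('a \<times> 'a) set \<Rightarrow> ('m \<Rightarrow> 'a) \<Rightarrow> bool"
  where
  "pseudo_orbit X \<alpha> K V \<xi> \<longleftrightarrow>
     (\<forall>m. \<xi> m \<in> topspace X) \<and> (\<forall>k\<in>K. \<forall>m. (\<alpha> k (\<xi> m), \<xi> (k * m)) \<in> V)"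

definition traced_by ::
    "('m \<Rightarrow> 'a \<Rightarrow> 'a) \<Rightarrow> ('a \<times> 'a) set \<Rightarrow> ('m \<Rightarrow> 'a) \<Rightarrow> 'a \<Rightarrow> bool" where
  "traced_by \<alpha> U \<xi> x \<longleftrightarrow> (\<forall>m. (\<alpha> m x, \<xi> m) \<in> U)"

definition pseudo_orbit_tracing_property ::
    "'a topology \<Rightarrow> ('m::monoid_mult \<Rightarrow> 'a \<Rightarrow> 'a) \<Rightarrow> bool" where
  "pseudo_orbit_tracing_property X \<alpha> \<longleftrightarrow>
     (\<forall>U. entourage X U \<longrightarrow>
        (\<exists>K V. finite K \<and> entourage X V \<and>
           (\<forall>\<xi>. pseudo_orbit X \<alpha> K V \<xi> \<longrightarrow> (\<exists>x\<in>topspace X. traced_by \<alpha> U \<xi> x))))"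

text \<open>
  An action is represented by a function on the whole type, whose values outside
  \<^term>\<open>topspace X\<close> are arbitrary. Two representatives of the same action are related by
  every entourage of \<open>CMA X\<close>, and no notion here distinguishes them.
\<close>

definition CMA :: "'a topology \<Rightarrow> ('m::monoid_mult \<Rightarrow> 'a \<Rightarrow> 'a) set" where
  "CMA X = {\<alpha>. continuous_monoid_action X \<alpha>}"

definition CMA_basic_entourage ::
    "'a topology \<Rightarrow> 'm set \<Rightarrow> ('a \<times> 'a) set \<Rightarrow>
      (('m::monoid_mult \<Rightarrow> 'a \<Rightarrow> 'a) \<times> ('m \<Rightarrow> 'a \<Rightarrow> 'a)) set" where
  "CMA_basic_entourage X K U =
     {(\<alpha>, \<beta>). \<alpha> \<in> CMA X \<and> \<beta> \<in> CMA X \<and> (\<forall>k\<in>K. \<forall>x\<in>topspace X. (\<alpha> k x, \<beta> k x) \<in> U)}"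

definition CMA_entourage ::
    "'a topology \<Rightarrow> (('m::monoid_mult \<Rightarrow> 'a \<Rightarrow> 'a) \<times> ('m \<Rightarrow> 'a \<Rightarrow> 'a)) set \<Rightarrow> bool" where
  "CMA_entourage X F \<longleftrightarrow>
     F \<subseteq> CMA X \<times> CMA X \<and>
     (\<exists>K U. finite K \<and> entourage X U \<and> CMA_basic_entourage X K U \<subseteq> F)"

text \<open>The topology induced by this uniform structure: a set is open iff it contains, with each
  of its points \<open>\<alpha>\<close>, the section \<open>F[\<alpha>]\<close> of some entourage \<open>F\<close>.\<close>

definition CMA_topology :: "'a topology \<Rightarrow> ('m::monoid_mult \<Rightarrow> 'a \<Rightarrow> 'a) topology" where
  "CMA_topology X =
     topology (\<lambda>W. W \<subseteq> CMA X \<and> (\<forall>\<alpha>\<in>W. \<exists>F. CMA_entourage X F \<and> F `` {\<alpha>} \<subseteq> W))"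

definition topologically_stable ::
    "'a topology \<Rightarrow> ('m::monoid_mult \<Rightarrow> 'a \<Rightarrow> 'a) \<Rightarrow> bool" where
  "topologically_stable X \<alpha> \<longleftrightarrow>
     (\<forall>U. entourage X U \<longrightarrow>
        (\<exists>N. N \<subseteq> CMA X \<and> \<alpha> \<in> (CMA_topology X) interior_of N \<and>
           (\<forall>\<beta>\<in>N. \<exists>h. continuous_map X X h \<and>
              (\<forall>m. \<forall>x\<in>topspace X. \<alpha> m (h x) = h (\<beta> m x)) \<and>
              (\<forall>x\<in>topspace X. (h x, x) \<in> U))))"

lemma entourage_Int:
  assumes "entourage X U" "entourage X V"
  shows "entourage X (U \<inter> V)"
  using assms by (auto simp: entourage_def interior_of_Int)

lemma entourage_topspace: "entourage X (topspace X \<times> topspace X)"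
proof -
  have "openin (prod_topology X X) (topspace X \<times> topspace X)"
    by (simp add: openin_prod_Times_iff)
  then show ?thesis
    by (simp add: entourage_def interior_of_openin)
qed

lemma CMA_entourage_Int:
  assumes "CMA_entourage X F" "CMA_entourage X G"
  shows "CMA_entourage X (F \<inter> G)"
proof -
  obtain K U L V where "finite K" "entourage X U" "CMA_basic_entourage X K U \<subseteq> F"
    and "finite L" "entourage X V" "CMA_basic_entourage X L V \<subseteq> G"
    using assms unfolding CMA_entourage_def by blast
  moreover have "CMA_basic_entourage X (K \<union> L) (U \<inter> V) \<subseteq>
      CMA_basic_entourage X K U \<inter> CMA_basic_entourage X L V"
    by (auto simp: CMA_basic_entourage_def)
  ultimately have "finite (K \<union> L)" "entourage X (U \<inter> V)"
      "CMA_basic_entourage X (K \<union> L) (U \<inter> V) \<subseteq> F \<inter> G"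
    by (auto intro: entourage_Int)
  then show ?thesis
    using assms unfolding CMA_entourage_def by blast
qed

lemma openin_CMA_topology:
  fixes W :: "('m::monoid_mult \<Rightarrow> 'a \<Rightarrow> 'a) set"
  shows "openin (CMA_topology X) W \<longleftrightarrow>
     W \<subseteq> CMA X \<and> (\<forall>\<alpha>\<in>W. \<exists>F. CMA_entourage X F \<and> F `` {\<alpha>} \<subseteq> W)"
proof -
  have "istopology (\<lambda>W :: ('m \<Rightarrow> 'a \<Rightarrow> 'a) set.
      W \<subseteq> CMA X \<and> (\<forall>\<alpha>\<in>W. \<exists>F. CMA_entourage X F \<and> F `` {\<alpha>} \<subseteq> W))"
    unfolding istopology_def
  proof (intro conjI allI impI ballI)
    fix S T \<alpha>
    assume S: "S \<subseteq> CMA X \<and> (\<forall>\<alpha>\<in>S. \<exists>F. CMA_entourage X F \<and> F `` {\<alpha>} \<subseteq> S)"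
      and T: "T \<subseteq> CMA X \<and> (\<forall>\<alpha>\<in>T. \<exists>F. CMA_entourage X F \<and> F `` {\<alpha>} \<subseteq> T)"
      and \<alpha>: "\<alpha> \<in> S \<inter> T"
    obtain F G where "CMA_entourage X F" "F `` {\<alpha>} \<subseteq> S" "CMA_entourage X G" "G `` {\<alpha>} \<subseteq> T"
      using S T \<alpha> by blast
    then show "\<exists>F. CMA_entourage X F \<and> F `` {\<alpha>} \<subseteq> S \<inter> T"
      by (intro exI[of _ "F \<inter> G"]) (auto intro: CMA_entourage_Int)
  next
    fix \<K> \<alpha>
    assume K: "\<forall>S\<in>\<K>. S \<subseteq> CMA X \<and> (\<forall>\<alpha>\<in>S. \<exists>F. CMA_entourage X F \<and> F `` {\<alpha>} \<subseteq> S)"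
      and "\<alpha> \<in> \<Union>\<K>"
    then obtain S where "S \<in> \<K>" "\<alpha> \<in> S" by blast
    then obtain F where "CMA_entourage X F" "F `` {\<alpha>} \<subseteq> S" using K by blast
    then show "\<exists>F. CMA_entourage X F \<and> F `` {\<alpha>} \<subseteq> \<Union>\<K>" using \<open>S \<in> \<K>\<close> by blast
  qed blast+
  then show ?thesis
    unfolding CMA_topology_def by (simp only: topology_inverse')
qed

lemma topspace_CMA_topology:
  "topspace (CMA_topology X) = (CMA X :: ('m::monoid_mult \<Rightarrow> 'a \<Rightarrow> 'a) set)"
proof -
  have "CMA_entourage X (CMA X \<times> (CMA X :: ('m \<Rightarrow> 'a \<Rightarrow> 'a) set))"
    unfolding CMA_entourage_def
    by (intro conjI exI[of _ "{}"] exI[of _ "topspace X \<times> topspace X"])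
       (auto simp: entourage_topspace CMA_basic_entourage_def)
  then have "openin (CMA_topology X) (CMA X :: ('m \<Rightarrow> 'a \<Rightarrow> 'a) set)"
    unfolding openin_CMA_topology by blast
  then show ?thesis
    by (metis openin_CMA_topology openin_subset openin_topspace subset_antisym)
qed

end

theory Submission
  imports Defs
begin

text \<open>
  Shadowing gives the semiconjugacy pointwise. If \<open>\<beta>\<close> is close to \<open>\<alpha>\<close> on the finite set of \<open>k\<close>
  provided by the tracing property, then every orbit \<open>m \<mapsto> \<beta> m x\<close> of \<open>\<beta>\<close> is a pseudo-orbit of
  \<open>\<alpha>\<close>, because \<open>\<beta> (k * m) x = \<beta> k (\<beta> m x)\<close> is close to \<open>\<alpha> k (\<beta> m x)\<close>. Hence it is traced by the
  \<open>\<alpha>\<close>-orbit of some point \<open>h x\<close>. If the tracing precision \<open>W\<close> is symmetric and \<open>W O W\<close> lies in an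
  expansivity entourage, this point is unique: two tracing points stay close along their
  whole orbits.

  Uniqueness yields all properties of \<open>h\<close>. The point \<open>\<alpha> n (h x)\<close> traces the \<open>\<beta>\<close>-orbit of
  \<open>\<beta> n x\<close>, so it equals \<open>h (\<beta> n x)\<close>; and the graph of \<open>h\<close> is exactly the set of pairs
  \<open>(x, y)\<close> such that \<open>(\<alpha> m y, \<beta> m x) \<in> W\<close> for all \<open>m\<close>. When \<open>W\<close> is closed, so is this graph, and a
  map with closed graph into a compact space is continuous. This gives continuity without
  any uniform estimate, in which expansivity would have to be applied on finite parts of \<open>M\<close>.
  Closeness of \<open>h\<close> to the identity is tracing at \<open>m = 1\<close>.

  The topological input is thus the existence of closed symmetric entourages \<open>W\<close> with \<open>W O W\<close>
  inside a given entourage (\<open>closed_symmetric_half_entourage\<close>). It serves a second time in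
  \<open>interior_of_CMA_basic_entourage_section\<close>, where it shows that the actions close to \<open>\<alpha>\<close> form
  a neighbourhood of \<open>\<alpha>\<close>.
\<close>

section \<open>Entourages of compact Hausdorff spaces\<close>

lemma entourage_of_open_subset:
  assumes "openin (prod_topology X X) O'" and "\<And>x. x \<in> topspace X \<Longrightarrow> (x, x) \<in> O'"
    and "O' \<subseteq> E" and "E \<subseteq> topspace X \<times> topspace X"
  shows "entourage X E"
  using assms interior_of_maximal[of O' E "prod_topology X X"] unfolding entourage_def by blast

text \<open>
  Cover the space by finitely many open sets \<open>B p\<close>, each contained in the interior of a closed set
  \<open>D p\<close> that is small of order \<open>E\<close>, and let \<open>W\<close> consist of the pairs that, for every \<open>p\<close>, either both
  lie in \<open>D p\<close> or both avoid \<open>B p\<close>. A middle point \<open>y\<close> of a composable pair lies in some \<open>B p\<close>,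
  which forces both neighbours into this \<open>D p\<close>. The intermediate sets \<open>B p \<subseteq> C p \<subseteq> A p \<subseteq> D p\<close> leave
  room for an open neighbourhood of the diagonal inside the closed set \<open>W\<close>.
\<close>
lemma closed_symmetric_half_entourage:
  assumes "compact_space X" and "regular_space X" and "entourage X E"
  obtains W where "entourage X W" "closedin (prod_topology X X) W" "sym W" "W O W \<subseteq> E"
proof -
  have reg: "\<exists>U V. openin X U \<and> closedin X V \<and> x \<in> U \<and> U \<subseteq> V \<and> V \<subseteq> S"
    if "openin X S" "x \<in> S" for x S
    using assms(2) that by (simp add: neighbourhood_base_of flip: neighbourhood_base_of_closedin)
  have "\<exists>A B C D. openin X B \<and> closedin X C \<and> openin X A \<and> closedin X D \<and>
          x \<in> B \<and> B \<subseteq> C \<and> C \<subseteq> A \<and> A \<subseteq> D \<and> D \<times> D \<subseteq> E" if x: "x \<in> topspace X" for x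
  proof -
    have "(x, x) \<in> prod_topology X X interior_of E"
      using assms(3) x by (simp add: entourage_def)
    then obtain S T where ST: "openin X S" "openin X T" "x \<in> S" "x \<in> T"
        "S \<times> T \<subseteq> prod_topology X X interior_of E"
      using openin_prod_topology_alt[of X X "prod_topology X X interior_of E"]
      by (metis openin_interior_of)
    obtain A D where "openin X A" "closedin X D" "x \<in> A" "A \<subseteq> D" "D \<subseteq> S \<inter> T"
      using reg[of "S \<inter> T" x] ST openin_Int by blast
    moreover obtain B C where "openin X B" "closedin X C" "x \<in> B" "B \<subseteq> C" "C \<subseteq> A"
      using reg[of A x] calculation by blast
    moreover have "D \<times> D \<subseteq> E"
      using calculation ST(5) interior_of_subset[of "prod_topology X X" E] by blast
    ultimately show ?thesis by blast
  qed
  then obtain A B C D where ABCD: "\<And>x. x \<in> topspace X \<Longrightarrow>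
      openin X (B x) \<and> closedin X (C x) \<and> openin X (A x) \<and> closedin X (D x) \<and>
      x \<in> B x \<and> B x \<subseteq> C x \<and> C x \<subseteq> A x \<and> A x \<subseteq> D x \<and> D x \<times> D x \<subseteq> E"
    by metis
  then have opB: "openin X (B x)" and clC: "closedin X (C x)"
    and opA: "openin X (A x)" and clD: "closedin X (D x)" and xB: "x \<in> B x"
    and BC: "B x \<subseteq> C x" and CA: "C x \<subseteq> A x" and AD: "A x \<subseteq> D x" and DE: "D x \<times> D x \<subseteq> E"
    if "x \<in> topspace X" for x
    using that by blast+
  have "(\<forall>U\<in>B ` topspace X. openin X U) \<and> topspace X \<subseteq> \<Union> (B ` topspace X)"
    using opB xB by auto
  then obtain \<F> where "finite \<F>" "\<F> \<subseteq> B ` topspace X" "topspace X \<subseteq> \<Union>\<F>"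
    using assms(1) unfolding compact_space_alt by meson
  then obtain F where F: "finite F" "F \<subseteq> topspace X" "topspace X \<subseteq> \<Union> (B ` F)"
    by (metis finite_subset_image)
  let ?T = "topspace X"
  define W where
    "W = (?T \<times> ?T) \<inter> (\<Inter>p\<in>F. D p \<times> D p \<union> (?T - B p) \<times> (?T - B p))"
  define W' where
    "W' = (\<Inter>p\<in>F. A p \<times> A p \<union> (?T - C p) \<times> (?T - C p)) \<inter> topspace (prod_topology X X)"
  have "openin (prod_topology X X) (A p \<times> A p \<union> (?T - C p) \<times> (?T - C p))" if "p \<in> F" for p
    using opA clC that F(2)
    by (intro openin_Un) (auto simp: openin_prod_Times_iff intro!: openin_diff)
  then have "openin (prod_topology X X) W'"
    unfolding W'_def using F(1) by blast
  moreover have "(x, x) \<in> W'" if "x \<in> ?T" for x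
    using that CA F(2) unfolding W'_def by auto
  moreover have "W' \<subseteq> W"
    using AD BC F(2) unfolding W'_def W_def by fastforce
  moreover have "W \<subseteq> ?T \<times> ?T"
    unfolding W_def by blast
  ultimately have ent: "entourage X W"
    by (rule entourage_of_open_subset)
  have "closedin (prod_topology X X) (D p \<times> D p \<union> (?T - B p) \<times> (?T - B p))" if "p \<in> F" for p
    using opB clD that F(2)
    by (intro closedin_Un) (auto simp: closedin_prod_Times_iff intro!: closedin_diff)
  then have "closedin (prod_topology X X) (\<Inter> (insert (topspace (prod_topology X X))
      ((\<lambda>p. D p \<times> D p \<union> (?T - B p) \<times> (?T - B p)) ` F)))"
    by (intro closedin_Inter) (auto simp: closedin_prod_Times_iff)
  then have "closedin (prod_topology X X) W"
    unfolding W_def by simp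
  moreover have "sym W"
    unfolding W_def by (rule symI) auto
  moreover have "W O W \<subseteq> E"
  proof clarify
    fix x y z
    assume xy: "(x, y) \<in> W" and yz: "(y, z) \<in> W"
    then have "y \<in> ?T" by (simp add: W_def)
    then obtain p where p: "p \<in> F" "y \<in> B p" using F(3) by blast
    then have "x \<in> D p" "z \<in> D p" using xy yz unfolding W_def by auto
    then show "(x, z) \<in> E" using DE p F(2) by blast
  qed
  ultimately show thesis using that ent by blast
qed

section \<open>Neighbourhoods in the space of actions\<close>

text \<open>
  The section of a basic entourage need not be open. The usual construction for uniform
  spaces supplies an open subset: the actions that still have a whole basic section inside the
  given one. Halving the entourage \<open>V\<close> of such an action shows that this subset is open.
\<close>
lemma interior_of_CMA_basic_entourage_section:
  fixes \<alpha> :: "'m::monoid_mult \<Rightarrow> 'a \<Rightarrow> 'a"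
  assumes "compact_space X" and "regular_space X" and "\<alpha> \<in> CMA X"
    and "finite K" and "entourage X U"
  shows "\<alpha> \<in> CMA_topology X interior_of (CMA_basic_entourage X K U `` {\<alpha>})"
proof -
  let ?N = "CMA_basic_entourage X K U `` {\<alpha>}"
  define P where
    "P = {\<beta> \<in> CMA X. \<exists>L V. finite L \<and> entourage X V \<and> CMA_basic_entourage X L V `` {\<beta>} \<subseteq> ?N}"
  have refl: "(\<beta>, \<beta>) \<in> CMA_basic_entourage X L V"
    if "\<beta> \<in> CMA X" "entourage X V" for \<beta> :: "'m \<Rightarrow> 'a \<Rightarrow> 'a" and L V
  proof -
    have "\<beta> k x \<in> topspace X" if "x \<in> topspace X" for k x
    proof -
      have "continuous_map X X (\<beta> k)"
        using \<open>\<beta> \<in> CMA X\<close>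
        by (simp add: CMA_def continuous_monoid_action_def continuous_semigroup_action_def)
      then show ?thesis
        using that continuous_map_image_subset_topspace by blast
    qed
    moreover have "(y, y) \<in> V" if "y \<in> topspace X" for y
      using \<open>entourage X V\<close> that interior_of_subset[of "prod_topology X X" V]
      unfolding entourage_def by blast
    ultimately show ?thesis using that by (simp add: CMA_basic_entourage_def)
  qed
  have "openin (CMA_topology X) P"
    unfolding openin_CMA_topology
  proof (intro conjI ballI)
    show "P \<subseteq> CMA X" unfolding P_def by blast
    fix \<beta>
    assume "\<beta> \<in> P"
    then obtain L V where LV: "finite L" "entourage X V" "CMA_basic_entourage X L V `` {\<beta>} \<subseteq> ?N"
      unfolding P_def by blast
    obtain V' where V': "entourage X V'" "V' O V' \<subseteq> V"
      using closed_symmetric_half_entourage[OF assms(1,2) LV(2)] by metis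
    have comp: "CMA_basic_entourage X L V' O CMA_basic_entourage X L V' \<subseteq> CMA_basic_entourage X L V"
      using V'(2) unfolding CMA_basic_entourage_def by blast
    have "CMA_basic_entourage X L V' `` {\<beta>} \<subseteq> P"
    proof
      fix \<gamma>
      assume \<gamma>: "\<gamma> \<in> CMA_basic_entourage X L V' `` {\<beta>}"
      then have "CMA_basic_entourage X L V' `` {\<gamma>} \<subseteq> ?N" using comp LV(3) by blast
      moreover have "\<gamma> \<in> CMA X" using \<gamma> by (simp add: CMA_basic_entourage_def)
      ultimately show "\<gamma> \<in> P" unfolding P_def using LV(1) V'(1) by blast
    qed
    moreover have "CMA_entourage X (CMA_basic_entourage X L V')"
      unfolding CMA_entourage_def using LV(1) V'(1) by (auto simp: CMA_basic_entourage_def)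
    ultimately show "\<exists>F. CMA_entourage X F \<and> F `` {\<beta>} \<subseteq> P" by blast
  qed
  moreover have "\<alpha> \<in> P" unfolding P_def using assms by blast
  moreover have "P \<subseteq> ?N" unfolding P_def using refl by blast
  ultimately show ?thesis by (auto simp: interior_of_def)
qed

section \<open>The semiconjugacy\<close>

text \<open>
  The preimage of a closed set \<open>C\<close> is the projection of the part of the graph over \<open>C\<close>, and
  projecting along a compact factor is a closed map.
\<close>
lemma continuous_map_of_closed_graph:
  assumes "compact_space Y" and "h ` topspace X \<subseteq> topspace Y"
    and "closedin (prod_topology X Y) {(x, y). x \<in> topspace X \<and> y = h x}"
  shows "continuous_map X Y h"
  unfolding continuous_map_closedin
proof (intro conjI allI impI Pi_I)
  show "h x \<in> topspace Y" if "x \<in> topspace X" for x using that assms(2) by blast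
  fix C
  assume C: "closedin Y C"
  let ?G = "{(x, y). x \<in> topspace X \<and> y = h x} \<inter> topspace X \<times> C"
  have "closedin (prod_topology X Y) ?G"
    using assms(3) C by (intro closedin_Int) (auto simp: closedin_prod_Times_iff)
  then have "closedin X (fst ` ?G)"
    using Abstract_Topological_Spaces.closed_map_fst[OF assms(1), of X]
    unfolding closed_map_def by blast
  moreover have "fst ` ?G = {x \<in> topspace X. h x \<in> C}" by force
  ultimately show "closedin X {x \<in> topspace X. h x \<in> C}" by simp
qed

lemma closedin_tracing_relation:
  assumes "closedin (prod_topology X X) W"
    and "\<And>m. continuous_map X X (\<alpha> m)" and "\<And>m. continuous_map X X (\<beta> m)"
  shows "closedin (prod_topology X X)
    {(x, y). x \<in> topspace X \<and> y \<in> topspace X \<and> traced_by \<alpha> W (\<lambda>m. \<beta> m x) y}"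
proof -
  have "closedin (prod_topology X X)
      {z \<in> topspace (prod_topology X X). (\<alpha> m (snd z), \<beta> m (fst z)) \<in> W}" for m
  proof -
    have "continuous_map (prod_topology X X) (prod_topology X X) (\<lambda>z. (\<alpha> m (snd z), \<beta> m (fst z)))"
      using continuous_map_compose[OF continuous_map_snd assms(2), of X m]
        continuous_map_compose[OF continuous_map_fst assms(3), of X m]
      by (simp add: continuous_map_pairwise o_def)
    then show ?thesis using assms(1) by (rule closedin_continuous_map_preimage)
  qed
  then have "closedin (prod_topology X X)
      (\<Inter>m. {z \<in> topspace (prod_topology X X). (\<alpha> m (snd z), \<beta> m (fst z)) \<in> W})"
    by blast
  moreover have "(\<Inter>m. {z \<in> topspace (prod_topology X X). (\<alpha> m (snd z), \<beta> m (fst z)) \<in> W}) =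
      {(x, y). x \<in> topspace X \<and> y \<in> topspace X \<and> traced_by \<alpha> W (\<lambda>m. \<beta> m x) y}"
    by (auto simp: traced_by_def)
  ultimately show ?thesis by simp
qed

text \<open>
  The map \<open>h\<close> sends \<open>x\<close> to the unique point tracing its \<open>\<beta>\<close>-orbit; uniqueness identifies the
  graph of \<open>h\<close> with the closed relation above and \<open>\<alpha> n (h x)\<close> with \<open>h (\<beta> n x)\<close>.
\<close>
lemma semiconjugacy_of_unique_tracing:
  fixes \<alpha> \<beta> :: "'m::monoid_mult \<Rightarrow> 'a \<Rightarrow> 'a"
  assumes "compact_space X"
    and \<alpha>: "continuous_monoid_action X \<alpha>" and \<beta>: "continuous_monoid_action X \<beta>"
    and W: "closedin (prod_topology X X) W"
    and traced: "\<And>x. x \<in> topspace X \<Longrightarrow> \<exists>y\<in>topspace X. traced_by \<alpha> W (\<lambda>m. \<beta> m x) y"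
    and unique: "\<And>\<xi> y z. y \<in> topspace X \<Longrightarrow> z \<in> topspace X \<Longrightarrow>
      traced_by \<alpha> W \<xi> y \<Longrightarrow> traced_by \<alpha> W \<xi> z \<Longrightarrow> y = z"
  shows "\<exists>h. continuous_map X X h \<and> (\<forall>m. \<forall>x\<in>topspace X. \<alpha> m (h x) = h (\<beta> m x)) \<and>
    (\<forall>x\<in>topspace X. (h x, x) \<in> W)"
proof -
  have cont: "continuous_map X X (\<alpha> m)" "continuous_map X X (\<beta> m)" for m
    using \<alpha> \<beta> by (auto simp: continuous_monoid_action_def continuous_semigroup_action_def)
  have closed: "\<alpha> m x \<in> topspace X" "\<beta> m x \<in> topspace X" if "x \<in> topspace X" for m x
    using continuous_map_image_subset_topspace[OF cont(1)]
      continuous_map_image_subset_topspace[OF cont(2)] that by blast+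
  have act: "\<alpha> m (\<alpha> n x) = \<alpha> (m * n) x" "\<beta> m (\<beta> n x) = \<beta> (m * n) x" "\<alpha> 1 x = x" "\<beta> 1 x = x"
    if "x \<in> topspace X" for m n x
    using \<alpha> \<beta> that by (auto simp: continuous_monoid_action_def continuous_semigroup_action_def)
  obtain h where h: "\<And>x. x \<in> topspace X \<Longrightarrow> h x \<in> topspace X"
      "\<And>x. x \<in> topspace X \<Longrightarrow> traced_by \<alpha> W (\<lambda>m. \<beta> m x) (h x)"
    using traced by metis
  have "{(x, y). x \<in> topspace X \<and> y = h x} =
      {(x, y). x \<in> topspace X \<and> y \<in> topspace X \<and> traced_by \<alpha> W (\<lambda>m. \<beta> m x) y}"
    using h unique by blast
  then have "continuous_map X X h"
    using closedin_tracing_relation[OF W cont] h(1) assms(1)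
    by (intro continuous_map_of_closed_graph) auto
  moreover have "\<alpha> n (h x) = h (\<beta> n x)" if x: "x \<in> topspace X" for n x
  proof -
    have "(\<alpha> m (\<alpha> n (h x)), \<beta> m (\<beta> n x)) \<in> W" for m
      using h x by (simp add: act traced_by_def)
    then have "traced_by \<alpha> W (\<lambda>m. \<beta> m (\<beta> n x)) (\<alpha> n (h x))"
      by (simp add: traced_by_def)
    moreover have "\<alpha> n (h x) \<in> topspace X" "\<beta> n x \<in> topspace X"
      using closed h(1) x by auto
    ultimately show ?thesis
      using unique[of "\<alpha> n (h x)" "h (\<beta> n x)" "\<lambda>m. \<beta> m (\<beta> n x)"] h by simp
  qed
  moreover have "(h x, x) \<in> W" if x: "x \<in> topspace X" for x
  proof -
    have "(\<alpha> 1 (h x), \<beta> 1 x) \<in> W" using h(2)[OF x] by (simp add: traced_by_def)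
    then show ?thesis using act(3,4) h(1) x by simp
  qed
  ultimately show ?thesis by blast
qed

theorem theorem1p1:
  fixes X :: "'a topology" and \<alpha> :: "'m::monoid_mult \<Rightarrow> 'a \<Rightarrow> 'a"
  assumes "compact_space X" and "Hausdorff_space X"
    and "continuous_monoid_action X \<alpha>"
    and "expansive X \<alpha>"
    and "pseudo_orbit_tracing_property X \<alpha>"
  shows "topologically_stable X \<alpha>"
  unfolding topologically_stable_def
proof (intro allI impI)
  fix U
  assume U: "entourage X U"
  have reg: "regular_space X"
    using assms(1,2) by (rule compact_Hausdorff_imp_regular_space)
  obtain E where E: "entourage X E"
      "\<And>x y. x \<in> topspace X \<Longrightarrow> y \<in> topspace X \<Longrightarrow> (\<And>m. (\<alpha> m x, \<alpha> m y) \<in> E) \<Longrightarrow> x = y"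
    using assms(4) unfolding expansive_def by metis
  \<comment> \<open>Half of \<open>E\<close> makes tracing unique; half of \<open>U\<close> is contained in \<open>U\<close>.\<close>
  obtain W where W: "entourage X W" "closedin (prod_topology X X) W" "sym W" "W O W \<subseteq> E \<inter> U"
    using closed_symmetric_half_entourage[OF assms(1) reg entourage_Int[OF E(1) U]] .
  have WU: "W \<subseteq> U"
  proof clarify
    fix x y
    assume xy: "(x, y) \<in> W"
    then have "(y, y) \<in> W"
      using W(1) interior_of_subset[of "prod_topology X X" W] unfolding entourage_def by blast
    then show "(x, y) \<in> U" using W(4) xy by blast
  qed
  have unique: "y = z" if "y \<in> topspace X" "z \<in> topspace X"
      "traced_by \<alpha> W \<xi> y" "traced_by \<alpha> W \<xi> z" for \<xi> y z
  proof (rule E(2)[OF that(1,2)])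
    fix m
    have "(\<alpha> m y, \<xi> m) \<in> W" "(\<xi> m, \<alpha> m z) \<in> W"
      using that(3,4) W(3) by (auto simp: traced_by_def dest: symD)
    then show "(\<alpha> m y, \<alpha> m z) \<in> E" using W(4) by blast
  qed
  obtain K V where KV: "finite K" "entourage X V"
      "\<And>\<xi>. pseudo_orbit X \<alpha> K V \<xi> \<Longrightarrow> \<exists>x\<in>topspace X. traced_by \<alpha> W \<xi> x"
    using assms(5) W(1) unfolding pseudo_orbit_tracing_property_def by blast
  let ?N = "CMA_basic_entourage X K V `` {\<alpha>}"
  have "\<alpha> \<in> CMA_topology X interior_of ?N"
    using assms(1,3) reg KV(1,2)
    by (intro interior_of_CMA_basic_entourage_section) (auto simp: CMA_def)
  moreover have "?N \<subseteq> CMA X"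
    by (auto simp: CMA_basic_entourage_def)
  moreover have "\<exists>h. continuous_map X X h \<and> (\<forall>m. \<forall>x\<in>topspace X. \<alpha> m (h x) = h (\<beta> m x)) \<and>
      (\<forall>x\<in>topspace X. (h x, x) \<in> U)" if "\<beta> \<in> ?N" for \<beta>
  proof -
    have \<beta>: "continuous_monoid_action X \<beta>"
      and near: "\<And>k x. k \<in> K \<Longrightarrow> x \<in> topspace X \<Longrightarrow> (\<alpha> k x, \<beta> k x) \<in> V"
      using that by (auto simp: CMA_basic_entourage_def CMA_def)
    have "pseudo_orbit X \<alpha> K V (\<lambda>m. \<beta> m x)" if x: "x \<in> topspace X" for x
    proof -
      have "continuous_map X X (\<beta> m)" for m
        using \<beta> by (simp add: continuous_monoid_action_def continuous_semigroup_action_def)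
      then have "\<beta> m x \<in> topspace X" for m
        using x continuous_map_image_subset_topspace by blast
      moreover have "\<beta> (k * m) x = \<beta> k (\<beta> m x)" for k m
        using \<beta> x by (simp add: continuous_monoid_action_def continuous_semigroup_action_def)
      ultimately show ?thesis using near by (simp add: pseudo_orbit_def)
    qed
    then have "\<exists>y\<in>topspace X. traced_by \<alpha> W (\<lambda>m. \<beta> m x) y" if "x \<in> topspace X" for x
      using KV(3) that by blast
    then have "\<exists>h. continuous_map X X h \<and> (\<forall>m. \<forall>x\<in>topspace X. \<alpha> m (h x) = h (\<beta> m x)) \<and>
        (\<forall>x\<in>topspace X. (h x, x) \<in> W)"
      by (rule semiconjugacy_of_unique_tracing[OF assms(1,3) \<beta> W(2) _ unique])
    then show ?thesis using WU by blast
  qed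
  ultimately show "\<exists>N. N \<subseteq> CMA X \<and> \<alpha> \<in> CMA_topology X interior_of N \<and>
      (\<forall>\<beta>\<in>N. \<exists>h. continuous_map X X h \<and> (\<forall>m. \<forall>x\<in>topspace X. \<alpha> m (h x) = h (\<beta> m x)) \<and>
        (\<forall>x\<in>topspace X. (h x, x) \<in> U))"
    by blast
qed

end
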